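(* Let $\varphi:\mathbb{R}\to\mathbb{R}$ be defined by $\varphi(x)=0$ if $x=0$ or $x=\frac1n$ for some positive integer $n$, and $\varphi(x)=1$ otherwise, and consider the problem $$\min_{x\in\mathbb{R}}\varphi(x)\quad\text{s.t.}\quad x=0,\ x^2=0,$$ whose only feasible point, and hence solution, is $x^*=0$. The function $\varphi$ is proper and lower semicontinuous, and the Polyak-Łojasiewicz constraint qualification (PŁCQ) holds at $x^*=0$; nevertheless there exist admissible parameters for the Safeguarded Augmented Lagrangian Method (SALM, described in the context) and a sequence $\{x^k\}\subseteq\mathbb{R}$ generated by SALM applied to this problem with these parameters, such that $\{x^k\}$ converges $\varphi$-attentively to $x^*=0$ (i.e. $x^k\to0$ and $\varphi(x^k)\to\varphi(0)$), while the corresponding sequence of Lagrange multipliers $\{\mu^k\}\subseteq\mathbb{R}^2$ is unbounded.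
   Context: Here there are no inequality constraints, $f\equiv0$, and $h:\mathbb{R}\to\mathbb{R}^2$, $h(x)=(x,x^2)^T$. $\|\cdot\|$ is the Euclidean norm. PŁCQ: let $\Phi(x)=\frac12\|h(x)\|^2$. PŁCQ holds at a feasible $x^*$ if there are $\nu>0$, $\delta>0$ with $\sqrt{\Phi(x)}\le\nu|\Phi'(x)|$ for all $x$ with $|x-x^*|<\delta$. Subdifferentials: for a proper lsc $\theta:\mathbb{R}\to\mathbb{R}\cup\{\pm\infty\}$ and $\bar x\in\operatorname{dom}\theta$, the Fréchet subdifferential is $\hat\partial\theta(\bar x)=\{v:\liminf_{x\to\bar x,\,x\ne\bar x}\frac{\theta(x)-\theta(\bar x)-v(x-\bar x)}{|x-\bar x|}\ge 0\}$, and the limiting (Mordukhovich) subdifferential $\partial\theta(\bar x)$ is the set of all $v$ for which there exist $x^k\to\bar x$ with $\theta(x^k)\to\theta(\bar x)$ and $v^k\to v$ with $v^k\in\hat\partial\theta(x^k)$ for all $k$. A point $\bar x\in\operatorname{dom}\theta$ is $\varepsilon$-stationary for $\min\theta$ if there is $\eta\in\partial\theta(\bar x)$ with $|\eta|\le\varepsilon$. SALM for this problem: the augmented Lagrangian is $\mathcal{L}_\rho(x,\mu)=\varphi(x)+\frac{\rho}{2}\left\|h(x)+\frac{\mu}{\rho}\right\|^2$ for $\rho>0$, $\mu\in\mathbb{R}^2$. Admissible parameters: $v_{\min}<v_{\max}$, a sequence $\{v^k\}_{k\ge0}\subseteq[v_{\min},v_{\max}]^2$, a sequence $\varepsilon_k>0$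 with $\varepsilon_k\to0$, a starting point $(x^0,\mu^0)\in\mathbb{R}\times\mathbb{R}^2$, $\rho_0>0$, $\tau\in(0,1)$, $\gamma>1$. For $k=0,1,2,\dots$ (without termination): (1) choose $x^{k+1}$ as an $\varepsilon_k$-stationary point of $\min_x\mathcal{L}_{\rho_k}(x,v^k)$; (2) set $\mu^{k+1}=v^k+\rho_kh(x^{k+1})$; (3) if $k=0$ or $\|h(x^{k+1})\|\le\tau\|h(x^k)\|$, set $\rho_{k+1}=\rho_k$; otherwise set $\rho_{k+1}=\gamma\rho_k$. A sequence $\{x^k\}$ is generated by SALM if it arises from some such run (with some admissible choice in step (1) at each iteration). *)

theory Defs
  imports "HOL-Analysis.Analysis"
begin

definition edom :: "(real \<Rightarrow> ereal) \<Rightarrow> real set" where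
  "edom \<theta> = {x. \<theta> x < \<infinity>}"

definition proper_fun :: "(real \<Rightarrow> ereal) \<Rightarrow> bool" where
  "proper_fun \<theta> \<longleftrightarrow> edom \<theta> \<noteq> {} \<and> (\<forall>x. \<theta> x \<noteq> -\<infinity>)"

definition lsc_fun :: "(real \<Rightarrow> ereal) \<Rightarrow> bool" where
  "lsc_fun \<theta> \<longleftrightarrow> (\<forall>x. \<theta> x \<le> Liminf (at x) \<theta>)"

text \<open>Both subdifferentials are meant for proper \<open>\<theta>\<close> (so \<open>\<theta> xbar\<close> is finite on the domain)
  and are empty outside the domain. The filter \<open>at xbar\<close> excludes the point \<open>xbar\<close> itself.\<close>

definition frechet_subdiff :: "(real \<Rightarrow> ereal) \<Rightarrow> real \<Rightarrow> real set" where
  "frechet_subdiff \<theta> xbar = {v. xbar \<in> edom \<theta> \<and>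
     Liminf (at xbar) (\<lambda>x. (\<theta> x - \<theta> xbar - ereal (v * (x - xbar))) / ereal \<bar>x - xbar\<bar>) \<ge> 0}"

definition limiting_subdiff :: "(real \<Rightarrow> ereal) \<Rightarrow> real \<Rightarrow> real set" where
  "limiting_subdiff \<theta> xbar = {v. xbar \<in> edom \<theta> \<and>
     (\<exists>(xs :: nat \<Rightarrow> real) (vs :: nat \<Rightarrow> real).
        xs \<longlonglongrightarrow> xbar \<and> (\<lambda>k. \<theta> (xs k)) \<longlonglongrightarrow> \<theta> xbar \<and> vs \<longlonglongrightarrow> v \<and>
        (\<forall>k. vs k \<in> frechet_subdiff \<theta> (xs k)))}"

definition eps_stationary :: "(real \<Rightarrow> ereal) \<Rightarrow> real \<Rightarrow> real \<Rightarrow> bool" where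
  "eps_stationary \<theta> \<epsilon> xbar \<longleftrightarrow>
     xbar \<in> edom \<theta> \<and> (\<exists>\<eta> \<in> limiting_subdiff \<theta> xbar. \<bar>\<eta>\<bar> \<le> \<epsilon>)"

definition feasible_set :: "(real \<Rightarrow> real^2) \<Rightarrow> real set" where
  "feasible_set h = {x. h x = 0}"

definition solution_set :: "(real \<Rightarrow> real) \<Rightarrow> (real \<Rightarrow> real^2) \<Rightarrow> real set" where
  "solution_set \<phi> h = {x \<in> feasible_set h. \<forall>y \<in> feasible_set h. \<phi> x \<le> \<phi> y}"

definition infeas :: "(real \<Rightarrow> real^2) \<Rightarrow> real \<Rightarrow> real" where
  "infeas h x = (1/2) * (norm (h x))\<^sup>2"

text \<open>The Polyak-Lojasiewicz constraint qualification, for differentiable \<open>h\<close>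
  (\<open>deriv\<close> is unspecified where \<open>infeas h\<close> is not differentiable).\<close>

definition PLCQ :: "(real \<Rightarrow> real^2) \<Rightarrow> real \<Rightarrow> bool" where
  "PLCQ h xstar \<longleftrightarrow> xstar \<in> feasible_set h \<and>
     (\<exists>\<nu>>0. \<exists>\<delta>>0. \<forall>x. \<bar>x - xstar\<bar> < \<delta> \<longrightarrow>
        sqrt (infeas h x) \<le> \<nu> * \<bar>deriv (infeas h) x\<bar>)"

definition attentive_conv :: "(real \<Rightarrow> real) \<Rightarrow> (nat \<Rightarrow> real) \<Rightarrow> real \<Rightarrow> bool" where
  "attentive_conv \<phi> x xbar \<longleftrightarrow> x \<longlonglongrightarrow> xbar \<and> (\<lambda>k. \<phi> (x k)) \<longlonglongrightarrow> \<phi> xbar"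

text \<open>The smooth part of the objective is zero, so it does not occur.\<close>

definition aug_lagr ::
  "(real \<Rightarrow> real) \<Rightarrow> (real \<Rightarrow> real^2) \<Rightarrow> real \<Rightarrow> real \<Rightarrow> real^2 \<Rightarrow> real" where
  "aug_lagr \<phi> h \<rho> x \<mu> = \<phi> x + \<rho> / 2 * (norm (h x + (1 / \<rho>) *\<^sub>R \<mu>))\<^sup>2"

definition SALM_admissible ::
  "real \<Rightarrow> real \<Rightarrow> (nat \<Rightarrow> real^2) \<Rightarrow> (nat \<Rightarrow> real) \<Rightarrow> real \<Rightarrow> real \<Rightarrow> real \<Rightarrow> bool" where
  "SALM_admissible vmin vmax v \<epsilon> \<rho>0 \<tau> \<gamma> \<longleftrightarrow>
     vmin < vmax \<and> (\<forall>k i. v k $ i \<in> {vmin..vmax}) \<and>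
     (\<forall>k. \<epsilon> k > 0) \<and> \<epsilon> \<longlonglongrightarrow> 0 \<and> \<rho>0 > 0 \<and> \<tau> \<in> {0<..<1} \<and> \<gamma> > 1"

definition SALM_run ::
  "(real \<Rightarrow> real) \<Rightarrow> (real \<Rightarrow> real^2) \<Rightarrow> (nat \<Rightarrow> real^2) \<Rightarrow> (nat \<Rightarrow> real) \<Rightarrow> real \<Rightarrow> real^2 \<Rightarrow>
   real \<Rightarrow> real \<Rightarrow> real \<Rightarrow> (nat \<Rightarrow> real) \<Rightarrow> (nat \<Rightarrow> real^2) \<Rightarrow> (nat \<Rightarrow> real) \<Rightarrow> bool" where
  "SALM_run \<phi> h v \<epsilon> x0 \<mu>0 \<rho>0 \<tau> \<gamma> x \<mu> \<rho> \<longleftrightarrow>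
     x 0 = x0 \<and> \<mu> 0 = \<mu>0 \<and> \<rho> 0 = \<rho>0 \<and>
     (\<forall>k. eps_stationary (\<lambda>y. ereal (aug_lagr \<phi> h (\<rho> k) y (v k))) (\<epsilon> k) (x (Suc k)) \<and>
          \<mu> (Suc k) = v k + \<rho> k *\<^sub>R h (x (Suc k)) \<and>
          \<rho> (Suc k) =
            (if k = 0 \<or> norm (h (x (Suc k))) \<le> \<tau> * norm (h (x k)) then \<rho> k else \<gamma> * \<rho> k))"

definition phi_ex :: "real \<Rightarrow> real" where
  "phi_ex x = (if x = 0 \<or> (\<exists>n::nat. n > 0 \<and> x = 1 / real n) then 0 else 1)"

definition h_ex :: "real \<Rightarrow> real^2" where
  "h_ex x = vector [x, x\<^sup>2]"

end

theory Submission
  imports Defs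
begin

text \<open>Every point \<open>1/n\<close> is isolated in the zero set of \<open>phi_ex\<close>, so the unit jump of \<open>phi_ex\<close> makes
  it a local minimizer, hence a stationary point, of every augmented Lagrangian. The
  method may therefore pick its iterates freely among these points. With \<open>v k = 0\<close> and iterates
  \<open>1/2^k\<close> the infeasibility never drops by more than the factor \<open>1/4\<close> per step, so for \<open>\<tau> = 1/8\<close> and
  \<open>\<gamma> = 4\<close> the penalty parameter is multiplied by 4 in all but the first step, and the first component
  \<open>\<rho> k * x (Suc k)\<close> of the multiplier grows like \<open>2^k\<close>.\<close>

text \<open>With \<open>v = 0\<close> the difference quotient is nonnegative near \<open>x\<close>,
  hence so is its lower limit.\<close>

lemma local_min_imp_zero_in_frechet_subdiff:
  fixes f :: "real \<Rightarrow> real"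
  assumes "eventually (\<lambda>y. f x \<le> f y) (at x)"
  shows "0 \<in> frechet_subdiff (\<lambda>y. ereal (f y)) x"
proof -
  have "eventually (\<lambda>y. 0 \<le> (ereal (f y) - ereal (f x) - ereal (0 * (y - x))) / ereal \<bar>y - x\<bar>) (at x)"
    using assms by eventually_elim (simp add: zero_ereal_def)
  then show ?thesis
    unfolding frechet_subdiff_def
    by (intro CollectI conjI Liminf_bounded) (simp add: edom_def)
qed

text \<open>Constant sequences serve as witnesses.\<close>

lemma frechet_subset_limiting_subdiff: "frechet_subdiff \<theta> x \<subseteq> limiting_subdiff \<theta> x"
proof
  fix v assume v: "v \<in> frechet_subdiff \<theta> x"
  then have "x \<in> edom \<theta>"
    by (simp add: frechet_subdiff_def)
  with v show "v \<in> limiting_subdiff \<theta> x"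
    unfolding limiting_subdiff_def
    by (intro CollectI conjI exI[of _ "\<lambda>_. x"] exI[of _ "\<lambda>_. v"]) simp_all
qed

lemma local_min_imp_eps_stationary:
  fixes f :: "real \<Rightarrow> real"
  assumes "eventually (\<lambda>y. f x \<le> f y) (at x)" and "0 \<le> e"
  shows "eps_stationary (\<lambda>y. ereal (f y)) e x"
  using local_min_imp_zero_in_frechet_subdiff[OF assms(1)] frechet_subset_limiting_subdiff assms(2)
  unfolding eps_stationary_def by (force simp: edom_def)

lemma h_ex_nth [simp]: "h_ex x $ 1 = x" "h_ex x $ 2 = x\<^sup>2"
  by (simp_all add: h_ex_def)

lemma norm_h_ex: "norm (h_ex x) = sqrt (x\<^sup>2 + x ^ 4)"
  by (simp add: norm_vec_def L2_set_def sum_2)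

lemma continuous_on_h_ex: "continuous_on S h_ex"
proof -
  have "continuous_on S (\<lambda>x. h_ex x $ i)" for i
    using exhaust_2[of i] by (elim disjE) (simp_all add: continuous_on_power)
  then have "continuous_on S (\<lambda>x. \<chi> i. h_ex x $ i)"
    by (rule continuous_on_vec_lambda)
  then show ?thesis by simp
qed

lemma h_ex_eq_0_iff: "h_ex x = 0 \<longleftrightarrow> x = 0"
  by (auto simp: vec_eq_iff forall_2)

lemma feasible_h_ex: "feasible_set h_ex = {0}"
  by (simp add: feasible_set_def h_ex_eq_0_iff)

lemma phi_ex_nonneg: "0 \<le> phi_ex x"
  by (simp add: phi_ex_def)

text \<open>The zeros form a convergent sequence together with its limit 0, a compact set.\<close>

lemma closed_phi_ex_zeros: "closed {x. phi_ex x = 0}"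
proof -
  have "{x. phi_ex x = 0} = insert 0 (range (\<lambda>n. 1 / real (Suc n)))"
    by (auto simp: phi_ex_def image_iff split: if_splits) (metis Suc_pred of_nat_Suc)
  moreover have "compact (insert (0::real) (range (\<lambda>n. 1 / real (Suc n))))"
    using LIMSEQ_inverse_real_of_nat
    by (intro compact_sequence_with_limit) (simp add: inverse_eq_divide)
  ultimately show ?thesis by (simp add: compact_imp_closed)
qed

text \<open>As \<open>phi_ex\<close> takes only the values 0 and 1, lower semicontinuity amounts to
  closedness of its zero set.\<close>

lemma lsc_phi_ex: "lsc_fun (\<lambda>x. ereal (phi_ex x))"
  unfolding lsc_fun_def
proof
  fix x
  show "ereal (phi_ex x) \<le> Liminf (at x) (\<lambda>x. ereal (phi_ex x))"
  proof (rule Liminf_bounded)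
    show "eventually (\<lambda>y. ereal (phi_ex x) \<le> ereal (phi_ex y)) (at x)"
    proof (cases "phi_ex x = 0")
      case True
      then show ?thesis by (simp add: phi_ex_nonneg)
    next
      case False
      then have "eventually (\<lambda>y. y \<in> - {x. phi_ex x = 0}) (at x)"
        using closed_phi_ex_zeros by (intro eventually_at_in_open') auto
      then show ?thesis
        by eventually_elim (auto simp: phi_ex_def split: if_splits)
    qed
  qed
qed

lemma phi_ex_eq_1_near_reciprocal:
  assumes m: "m > 0"
  shows "eventually (\<lambda>y. phi_ex y = 1) (at (1 / real m))"
proof -
  have 1: "((\<lambda>y. 1 / y) \<longlongrightarrow> real m) (at (1 / real m))"
    using m by (auto intro!: tendsto_eq_intros)
  \<comment> \<open>Positivity rules out \<open>y = 0\<close>, the only zero of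
    \<open>phi_ex\<close> that is not a reciprocal.\<close>
  have 2: "eventually (\<lambda>y. y > 0) (at (1 / real m))"
    using m by (intro order_tendstoD(1)[OF tendsto_ident_at]) auto
  have 3: "eventually (\<lambda>y. y \<noteq> 1 / real m) (at (1 / real m))"
    by (simp add: eventually_at_filter)
  show ?thesis
    using order_tendstoD(1)[OF 1, of "real m - 1", simplified]
      order_tendstoD(2)[OF 1, of "real m + 1", simplified] 2 3
  proof eventually_elim
    case (elim y)
    have "y \<noteq> 1 / real n" for n
    proof
      assume y: "y = 1 / real n"
      \<comment> \<open>Here \<open>1 / y\<close> is the integer \<open>n\<close>, strictly between
        \<open>m - 1\<close> and \<open>m + 1\<close>; for \<open>n = 0\<close> this rests on the
        convention \<open>1 / 0 = 0\<close>.\<close>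
      with elim(1,2) have "n = m" by simp
      with y elim(4) show False by simp
    qed
    with elim(3) show ?case by (auto simp: phi_ex_def)
  qed
qed

text \<open>Near \<open>1 / real m\<close> the continuous quadratic term drops by less than 1, which
  the jump of \<open>phi_ex\<close> outweighs.\<close>

lemma reciprocal_local_min_aug_lagr:
  assumes "m > 0"
  shows "eventually (\<lambda>y. aug_lagr phi_ex h_ex \<rho> (1 / real m) \<mu> \<le> aug_lagr phi_ex h_ex \<rho> y \<mu>)
           (at (1 / real m))"
proof -
  define g where "g = (\<lambda>y. \<rho> / 2 * (norm (h_ex y + (1 / \<rho>) *\<^sub>R \<mu>))\<^sup>2)"
  have "continuous_on UNIV g"
    unfolding g_def by (intro continuous_intros continuous_on_h_ex)
  then have "(g \<longlongrightarrow> g (1 / real m)) (at (1 / real m))"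
    by (simp add: continuous_on_def)
  then have "eventually (\<lambda>y. g (1 / real m) - 1 < g y) (at (1 / real m))"
    by (rule order_tendstoD) simp
  moreover have "phi_ex (1 / real m) = 0"
    using assms by (auto simp: phi_ex_def)
  ultimately have "eventually (\<lambda>y. phi_ex (1 / real m) + g (1 / real m) \<le> phi_ex y + g y)
      (at (1 / real m))"
    using phi_ex_eq_1_near_reciprocal[OF assms] by (auto elim: eventually_elim2)
  then show ?thesis
    by (simp add: aug_lagr_def g_def)
qed

lemma PLCQ_h_ex: "PLCQ h_ex 0"
proof -
  have inf: "infeas h_ex = (\<lambda>x. (x\<^sup>2 + x ^ 4) / 2)"
    by (simp add: fun_eq_iff infeas_def norm_h_ex)
  have d: "deriv (infeas h_ex) x = x + 2 * x ^ 3" for x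
    unfolding inf by (rule DERIV_imp_deriv) (auto intro!: derivative_eq_intros)
  have "sqrt (infeas h_ex x) \<le> 1 * \<bar>deriv (infeas h_ex) x\<bar>" for x
  proof -
    have "(x\<^sup>2 + x ^ 4) / 2 \<le> (x + 2 * x ^ 3)\<^sup>2"
    proof -
      \<comment> \<open>Only even powers with positive coefficients remain, so
        \<open>\<nu> = 1\<close> works for every \<open>x\<close>.\<close>
      have "(x + 2 * x ^ 3)\<^sup>2 - (x\<^sup>2 + x ^ 4) / 2 = x\<^sup>2 / 2 + 7 / 2 * x ^ 4 + 4 * x ^ 6"
        by (simp add: eval_nat_numeral field_simps)
      also have "\<dots> \<ge> 0"
        by simp
      finally show ?thesis by simp
    qed
    then have "sqrt ((x\<^sup>2 + x ^ 4) / 2) \<le> sqrt ((x + 2 * x ^ 3)\<^sup>2)"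
      by (rule real_sqrt_le_mono)
    then show ?thesis
      unfolding d by (simp add: inf)
  qed
  then show ?thesis
    unfolding PLCQ_def feasible_h_ex by (auto intro!: exI[of _ 1])
qed

text \<open>Halving \<open>x\<close> divides the two components by 2 and by 4, so the norm shrinks
  at most by the factor 4.\<close>

lemma norm_h_ex_half: "norm (h_ex x) \<le> 4 * norm (h_ex (x / 2))"
proof -
  have "sqrt (x\<^sup>2 + x ^ 4) \<le> sqrt (16 * ((x / 2)\<^sup>2 + (x / 2) ^ 4))"
    by (simp add: power_divide)
  also have "\<dots> = 4 * norm (h_ex (x / 2))"
    by (simp only: real_sqrt_mult norm_h_ex) simp
  finally show ?thesis by (simp add: norm_h_ex)
qed

theorem mainTheorem3:
  shows "feasible_set h_ex = {0} \<and> solution_set phi_ex h_ex = {0} \<and>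
    proper_fun (\<lambda>x. ereal (phi_ex x)) \<and> lsc_fun (\<lambda>x. ereal (phi_ex x)) \<and>
    PLCQ h_ex 0 \<and>
    (\<exists>vmin vmax v \<epsilon> x0 \<mu>0 \<rho>0 \<tau> \<gamma>.
       SALM_admissible vmin vmax v \<epsilon> \<rho>0 \<tau> \<gamma> \<and>
       (\<exists>x \<mu> \<rho>.
          SALM_run phi_ex h_ex v \<epsilon> x0 \<mu>0 \<rho>0 \<tau> \<gamma> x \<mu> \<rho> \<and>
          attentive_conv phi_ex x 0 \<and>
          \<not> bounded (range \<mu>)))"
proof -
  \<comment> \<open>Writing the denominator as a cast natural number gives each iterate the shape
    \<open>1 / real m\<close>.\<close>
  define x :: "nat \<Rightarrow> real" where "x = (\<lambda>k. 1 / real (2 ^ k))"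
  \<comment> \<open>Truncated subtraction gives \<open>\<rho> 0 = \<rho> 1 = 1\<close>: the first step keeps the penalty parameter.\<close>
  define \<rho> :: "nat \<Rightarrow> real" where "\<rho> = (\<lambda>k. 4 ^ (k - 1))"
  define \<mu> :: "nat \<Rightarrow> real^2"
    where "\<mu> = (\<lambda>k. case k of 0 \<Rightarrow> 0 | Suc j \<Rightarrow> \<rho> j *\<^sub>R h_ex (x (Suc j)))"
  \<comment> \<open>Any positive null sequence would do, since 0 itself is a subgradient at every
    iterate.\<close>
  define \<epsilon> :: "nat \<Rightarrow> real" where "\<epsilon> = (\<lambda>k. 1 / real (Suc k))"
  have "\<epsilon> \<longlonglongrightarrow> 0"
    unfolding \<epsilon>_def using LIMSEQ_inverse_real_of_nat by (simp add: inverse_eq_divide)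
  then have adm: "SALM_admissible 0 1 (\<lambda>_. 0) \<epsilon> 1 (1/8) 4"
    by (simp add: SALM_admissible_def \<epsilon>_def)
  have stat: "eps_stationary (\<lambda>y. ereal (aug_lagr phi_ex h_ex (\<rho> k) y 0)) (\<epsilon> k) (x (Suc k))" for k
    unfolding x_def
    by (intro local_min_imp_eps_stationary reciprocal_local_min_aug_lagr) (auto simp: \<epsilon>_def)
  have slow: "\<not> norm (h_ex (x (Suc k))) \<le> 1/8 * norm (h_ex (x k))" for k
  proof -
    have "norm (h_ex (x k)) \<le> 4 * norm (h_ex (x (Suc k)))"
      using norm_h_ex_half[of "x k"] by (simp add: x_def mult.commute)
    moreover have "norm (h_ex (x k)) > 0"
      by (simp add: h_ex_eq_0_iff x_def)
    ultimately show ?thesis by linarith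
  qed
  \<comment> \<open>By \<open>slow\<close> the decrease test always fails, so the penalty is kept
    only when \<open>k = 0\<close>.\<close>
  have \<rho>_Suc: "\<rho> (Suc k) = (if k = 0 then \<rho> k else 4 * \<rho> k)" for k
    by (cases k) (simp_all add: \<rho>_def)
  have init: "x 0 = 1" "\<mu> 0 = 0" "\<rho> 0 = 1"
    by (simp_all add: x_def \<mu>_def \<rho>_def)
  have \<mu>_Suc: "\<mu> (Suc k) = 0 + \<rho> k *\<^sub>R h_ex (x (Suc k))" for k
    by (simp add: \<mu>_def)
  have run: "SALM_run phi_ex h_ex (\<lambda>_. 0) \<epsilon> 1 0 1 (1/8) 4 x \<mu> \<rho>"
    unfolding SALM_run_def using stat slow \<rho>_Suc \<mu>_Suc init by metis
  have "x \<longlonglongrightarrow> 0"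
    unfolding x_def using LIMSEQ_realpow_zero[of "1/2::real"] by (simp add: power_one_over)
  moreover have phi_x: "phi_ex (x k) = 0" for k
    by (auto simp: phi_ex_def x_def intro: exI[of _ "2 ^ k"])
  ultimately have att: "attentive_conv phi_ex x 0"
    by (simp add: attentive_conv_def phi_ex_def[of 0])
  have "\<not> bounded (range \<mu>)"
  proof
    assume "bounded (range \<mu>)"
    then obtain B where B: "norm (\<mu> k) \<le> B" for k
      by (auto simp: bounded_iff)
    obtain n where n: "4 * B < 2 ^ n"
      using real_arch_pow[of 2 "4 * B"] by auto
    \<comment> \<open>The index is shifted by 2 because \<open>\<mu> (Suc (Suc n))\<close> involves
      \<open>\<rho> (Suc n) = 4 ^ n\<close>.\<close>
    have "\<mu> (Suc (Suc n)) $ 1 = 4 ^ n / 2 ^ (n + 2)"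
      by (simp add: \<mu>_def \<rho>_def x_def)
    also have "\<dots> = 2 ^ n / 4"
      using power_mult_distrib[of "2::real" 2 n] by simp
    finally have "2 ^ n / 4 \<le> norm (\<mu> (Suc (Suc n)))"
      using component_le_norm_cart[of "\<mu> (Suc (Suc n))" 1] by simp
    with B[of "Suc (Suc n)"] n show False by simp
  qed
  moreover have "solution_set phi_ex h_ex = {0}"
    by (auto simp: solution_set_def feasible_h_ex)
  moreover have "proper_fun (\<lambda>x. ereal (phi_ex x))"
    by (simp add: proper_fun_def edom_def)
  ultimately show ?thesis
    using feasible_h_ex lsc_phi_ex PLCQ_h_ex adm run att by blast
qed

end
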